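(* Let $\lambda\le\kappa$ be regular infinite cardinals and let $r:[\kappa^+]^2\to\lambda$ be a subadditive function. Then the family $\mathcal F_r=\{F^r_\xi(\beta):\xi<\lambda,\ \beta<\kappa^+\}$, where $F^r_\xi(\beta)=\{\alpha<\beta: r(\alpha,\beta)\le\xi\}$, is a strong $(\kappa,\lambda)$-matrix (indexed by $\kappa^+$).
   Context: Ordinals are identified with the set of smaller ordinals. A function $r:[\kappa^+]^2\to\lambda$ (written $r(\alpha,\beta)$ for $\alpha<\beta$) is subadditive if for all $\alpha<\beta<\gamma<\kappa^+$: (S1) $r(\alpha,\gamma)\le\max\{r(\alpha,\beta),r(\beta,\gamma)\}$, and (S2) $r(\alpha,\beta)\le\max\{r(\alpha,\gamma),r(\beta,\gamma)\}$. A strong $(\kappa,\lambda)$-matrix indexed by $\kappa^+$ is a family $\mathcal F=\{F_\xi(\alpha):\alpha<\kappa^+,\ \xi<\lambda\}$ of sets such that: (G1) $\bigcup_{\xi<\lambda}F_\xi(\alpha)=\alpha$ for every $\alpha<\kappa^+$; (G2) $F_\xi(\alpha)\subseteq F_\eta(\alpha)$ for each $\alpha<\kappa^+$ and all $\xi\le\eta<\lambda$; (G3) for all $\alpha\le\beta<\kappa^+$ and each $\xi<\lambda$ there is $\eta<\lambda$ with $F_\xi(\alpha)\subseteq F_\eta(\beta)$; (G4) for all $\alpha\le\beta<\kappa^+$ and each $\eta<\lambda$ there is $\xi<\lambda$ with $F_\eta(\beta)\cap\alpha\subseteq F_\xi(\alpha)$. *)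

theory Defs
  imports Main
begin

unbundle cardinal_syntax

text \<open>
  Cardinals are represented by library cardinal orders, i.e. reflexive well-orders of initial
  type, and the successor of \<open>\<kappa>\<close> by \<^term>\<open>cardSuc \<kappa>\<close>. The ordinals below such a cardinal \<open>K\<close> are
  the elements of \<^term>\<open>Field K\<close>: \<open>\<alpha> \<le> \<beta>\<close> is \<^prop>\<open>(\<alpha>, \<beta>) \<in> K\<close>, and the ordinal \<open>\<beta>\<close>, viewed as the
  set of smaller ordinals, is \<^term>\<open>underS K \<beta>\<close>; hence \<open>\<alpha> < \<beta>\<close> is \<^prop>\<open>\<alpha> \<in> underS K \<beta>\<close>.
  Since \<open>\<lambda>\<close> is reserved syntax, the cardinal \<open>\<lambda>\<close> of the mathematics is written \<open>\<mu>\<close>.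
  A function on increasing pairs is curried; its values elsewhere are irrelevant.
\<close>

definition pair_function :: "'a rel \<Rightarrow> 'b rel \<Rightarrow> ('a \<Rightarrow> 'a \<Rightarrow> 'b) \<Rightarrow> bool" where
  "pair_function K \<mu> r \<longleftrightarrow>
     (\<forall>\<beta> \<in> Field K. \<forall>\<alpha> \<in> underS K \<beta>. r \<alpha> \<beta> \<in> Field \<mu>)"

definition subadditive :: "'a rel \<Rightarrow> 'b rel \<Rightarrow> ('a set \<Rightarrow> 'a set \<Rightarrow> 'b) \<Rightarrow> bool" where
  "subadditive \<kappa> \<mu> r \<longleftrightarrow>
     pair_function (cardSuc \<kappa>) \<mu> r \<and>
     (\<forall>\<gamma> \<in> Field (cardSuc \<kappa>). \<forall>\<beta> \<in> underS (cardSuc \<kappa>) \<gamma>. \<forall>\<alpha> \<in> underS (cardSuc \<kappa>) \<beta>.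
        (r \<alpha> \<gamma>, wo_rel.max2 \<mu> (r \<alpha> \<beta>) (r \<beta> \<gamma>)) \<in> \<mu> \<and>
        (r \<alpha> \<beta>, wo_rel.max2 \<mu> (r \<alpha> \<gamma>) (r \<beta> \<gamma>)) \<in> \<mu>)"

text \<open>In a matrix, \<open>F \<xi> \<alpha>\<close> stands for \<open>F\<^sub>\<xi>(\<alpha>)\<close>.\<close>

definition strong_matrix :: "'a rel \<Rightarrow> 'b rel \<Rightarrow> ('b \<Rightarrow> 'a set \<Rightarrow> 'a set set) \<Rightarrow> bool" where
  "strong_matrix \<kappa> \<mu> F \<longleftrightarrow>
     (\<forall>\<alpha> \<in> Field (cardSuc \<kappa>). (\<Union>\<xi> \<in> Field \<mu>. F \<xi> \<alpha>) = underS (cardSuc \<kappa>) \<alpha>) \<and>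
     (\<forall>\<alpha> \<in> Field (cardSuc \<kappa>). \<forall>\<xi> \<in> Field \<mu>. \<forall>\<eta> \<in> Field \<mu>. (\<xi>, \<eta>) \<in> \<mu> \<longrightarrow> F \<xi> \<alpha> \<subseteq> F \<eta> \<alpha>) \<and>
     (\<forall>\<alpha> \<in> Field (cardSuc \<kappa>). \<forall>\<beta> \<in> Field (cardSuc \<kappa>). (\<alpha>, \<beta>) \<in> cardSuc \<kappa> \<longrightarrow>
        (\<forall>\<xi> \<in> Field \<mu>. \<exists>\<eta> \<in> Field \<mu>. F \<xi> \<alpha> \<subseteq> F \<eta> \<beta>)) \<and>
     (\<forall>\<alpha> \<in> Field (cardSuc \<kappa>). \<forall>\<beta> \<in> Field (cardSuc \<kappa>). (\<alpha>, \<beta>) \<in> cardSuc \<kappa> \<longrightarrow>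
        (\<forall>\<eta> \<in> Field \<mu>. \<exists>\<xi> \<in> Field \<mu>. F \<eta> \<beta> \<inter> underS (cardSuc \<kappa>) \<alpha> \<subseteq> F \<xi> \<alpha>))"

definition matrix_of ::
    "'a rel \<Rightarrow> 'b rel \<Rightarrow> ('a set \<Rightarrow> 'a set \<Rightarrow> 'b) \<Rightarrow> 'b \<Rightarrow> 'a set \<Rightarrow> 'a set set" where
  "matrix_of \<kappa> \<mu> r \<xi> \<beta> = {\<alpha> \<in> underS (cardSuc \<kappa>) \<beta>. (r \<alpha> \<beta>, \<xi>) \<in> \<mu>}"

end

theory Submission
  imports Defs
begin

text \<open>Membership of \<open>x\<close> in a level is a bound on a value of \<open>r\<close>, so
  (G1) and (G2) only use that \<open>\<mu>\<close> is a reflexive, transitive order. For (G3) and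
  (G4) with \<alpha> < \<beta>, the single value \<open>r \<alpha> \<beta>\<close> controls the
  passage between the two rows: for every x < \<alpha>, (S1) bounds \<open>r x \<beta>\<close> by
  the maximum of \<open>r x \<alpha>\<close> and \<open>r \<alpha> \<beta>\<close>, and (S2) bounds
  \<open>r x \<alpha>\<close> by the maximum of \<open>r x \<beta>\<close> and
  \<open>r \<alpha> \<beta>\<close>. Hence the maximum of the given index and
  \<open>r \<alpha> \<beta>\<close> is a witness that serves all x at once.\<close>

lemma wo_rel_of_Cinfinite: "Cinfinite \<mu> \<Longrightarrow> wo_rel \<mu>"
  by (simp add: wo_rel_def card_order_on_def)

lemma max2_least:
  assumes "wo_rel \<mu>" "(a, c) \<in> \<mu>" "(b, c) \<in> \<mu>"
  shows "(wo_rel.max2 \<mu> a b, c) \<in> \<mu>"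
  using assms by (simp add: wo_rel.max2_def)

theorem theorem5p2:
  fixes \<kappa> :: "'a rel" and \<mu> :: "'b rel" and r :: "'a set \<Rightarrow> 'a set \<Rightarrow> 'b"
  assumes "Cinfinite \<kappa>" and "regularCard \<kappa>"
    and "Cinfinite \<mu>" and "regularCard \<mu>"
    and "\<mu> \<le>o \<kappa>"
    and "subadditive \<kappa> \<mu> r"
  shows "strong_matrix \<kappa> \<mu> (matrix_of \<kappa> \<mu> r)"
proof -
  let ?K = "cardSuc \<kappa>"
  have wo: "wo_rel \<mu>"
    using assms(3) by (rule wo_rel_of_Cinfinite)
  note REFL = wo_rel.REFL[OF wo] and TRANS = wo_rel.TRANS[OF wo]
  have trans_\<mu>: "(a, c) \<in> \<mu>" if "(a, b) \<in> \<mu>" "(b, c) \<in> \<mu>" for a b c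
    using TRANS that by (rule transD)
  have r_Field: "r \<alpha> \<beta> \<in> Field \<mu>" if "\<beta> \<in> Field ?K" "\<alpha> \<in> underS ?K \<beta>" for \<alpha> \<beta>
    using assms(6) that unfolding subadditive_def pair_function_def by blast
  have S1: "(r \<alpha> \<gamma>, wo_rel.max2 \<mu> (r \<alpha> \<beta>) (r \<beta> \<gamma>)) \<in> \<mu>"
   and S2: "(r \<alpha> \<beta>, wo_rel.max2 \<mu> (r \<alpha> \<gamma>) (r \<beta> \<gamma>)) \<in> \<mu>"
    if "\<gamma> \<in> Field ?K" "\<beta> \<in> underS ?K \<gamma>" "\<alpha> \<in> underS ?K \<beta>" for \<alpha> \<beta> \<gamma>
    using assms(6) that unfolding subadditive_def by blast+
  have "Well_order ?K"
    using assms(1) cardSuc_Card_order by (auto simp: card_order_on_def)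
  then have "trans ?K" "antisym ?K"
    by (auto simp: order_on_defs)
  \<comment> \<open>Antisymmetry keeps the composed inequality strict: x = \<beta> would force
    \<alpha> = \<beta>.\<close>
  then have underS_trans: "x \<in> underS ?K \<beta>" if "x \<in> underS ?K \<alpha>" "\<alpha> \<in> underS ?K \<beta>" for x \<alpha> \<beta>
    using that transD[OF \<open>trans ?K\<close>] antisymD[OF \<open>antisym ?K\<close>] unfolding underS_def by blast
  \<comment> \<open>The witness is the maximum of \<xi> and
    \<open>r \<alpha> \<beta>\<close>.\<close>
  have bound: "\<exists>\<eta> \<in> Field \<mu>. (\<xi>, \<eta>) \<in> \<mu> \<and> (r \<alpha> \<beta>, \<eta>) \<in> \<mu>"
    if "\<beta> \<in> Field ?K" "\<alpha> \<in> underS ?K \<beta>" "\<xi> \<in> Field \<mu>" for \<alpha> \<beta> \<xi>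
    using wo_rel.max2_greater_among[OF wo that(3) r_Field[OF that(1,2)]] by (meson FieldI2)
  \<comment> \<open>The computation shared by (G3) and (G4): \<open>a\<close> and \<open>b\<close>
    are the values of \<open>r\<close> at x in the target and source rows, \<open>c\<close> is
    \<open>r \<alpha> \<beta>\<close>, and \<xi> is the given level.\<close>
  have le_eta: "(a, \<eta>) \<in> \<mu>"
    if "(a, wo_rel.max2 \<mu> b c) \<in> \<mu>" "(b, \<xi>) \<in> \<mu>" "(\<xi>, \<eta>) \<in> \<mu>" "(c, \<eta>) \<in> \<mu>" for a b c \<xi> \<eta>
    using trans_\<mu>[OF that(1) max2_least[OF wo trans_\<mu>[OF that(2,3)] that(4)]] .
  \<comment> \<open>Each x < \<alpha> appears at level \<open>r x \<alpha>\<close>, by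
    reflexivity.\<close>
  have G1: "(\<Union>\<xi> \<in> Field \<mu>. matrix_of \<kappa> \<mu> r \<xi> \<alpha>) = underS ?K \<alpha>" if "\<alpha> \<in> Field ?K" for \<alpha>
    using r_Field[OF that] refl_onD[OF REFL] unfolding matrix_of_def by fast
  have G2: "matrix_of \<kappa> \<mu> r \<xi> \<alpha> \<subseteq> matrix_of \<kappa> \<mu> r \<eta> \<alpha>" if "(\<xi>, \<eta>) \<in> \<mu>" for \<xi> \<eta> \<alpha>
    using trans_\<mu>[OF _ that] unfolding matrix_of_def by fast
  have G3: "\<exists>\<eta> \<in> Field \<mu>. matrix_of \<kappa> \<mu> r \<xi> \<alpha> \<subseteq> matrix_of \<kappa> \<mu> r \<eta> \<beta>"
    if \<beta>: "\<beta> \<in> Field ?K" and \<alpha>\<beta>: "(\<alpha>, \<beta>) \<in> ?K" and \<xi>: "\<xi> \<in> Field \<mu>" for \<alpha> \<beta> \<xi>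
  \<comment> \<open>On the diagonal \<open>r \<alpha> \<alpha>\<close> carries no information, but
    the given index itself is a witness.\<close>
  proof (cases "\<alpha> = \<beta>")
    case False
    then have \<alpha>: "\<alpha> \<in> underS ?K \<beta>" using \<alpha>\<beta> by (simp add: underS_def)
    obtain \<eta> where \<eta>: "\<eta> \<in> Field \<mu>" "(\<xi>, \<eta>) \<in> \<mu>" "(r \<alpha> \<beta>, \<eta>) \<in> \<mu>"
      using bound[OF \<beta> \<alpha> \<xi>] by blast
    \<comment> \<open>(S1) is applied to x < \<alpha> < \<beta>; \<open>underS_trans\<close>
      supplies x < \<beta>.\<close>
    have "matrix_of \<kappa> \<mu> r \<xi> \<alpha> \<subseteq> matrix_of \<kappa> \<mu> r \<eta> \<beta>"
      using le_eta[OF S1[OF \<beta> \<alpha>] _ \<eta>(2,3)] underS_trans[OF _ \<alpha>]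
      unfolding matrix_of_def by fast
    then show ?thesis using \<eta>(1) by blast
  qed (use \<xi> in blast)
  have G4: "\<exists>\<xi> \<in> Field \<mu>. matrix_of \<kappa> \<mu> r \<eta> \<beta> \<inter> underS ?K \<alpha> \<subseteq> matrix_of \<kappa> \<mu> r \<xi> \<alpha>"
    if \<beta>: "\<beta> \<in> Field ?K" and \<alpha>\<beta>: "(\<alpha>, \<beta>) \<in> ?K" and \<eta>: "\<eta> \<in> Field \<mu>" for \<alpha> \<beta> \<eta>
  proof (cases "\<alpha> = \<beta>")
    case False
    then have \<alpha>: "\<alpha> \<in> underS ?K \<beta>" using \<alpha>\<beta> by (simp add: underS_def)
    obtain \<xi> where \<xi>: "\<xi> \<in> Field \<mu>" "(\<eta>, \<xi>) \<in> \<mu>" "(r \<alpha> \<beta>, \<xi>) \<in> \<mu>"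
      using bound[OF \<beta> \<alpha> \<eta>] by blast
    \<comment> \<open>Intersecting with \<alpha> gives x < \<alpha>, which is what (S2)
      requires.\<close>
    have "matrix_of \<kappa> \<mu> r \<eta> \<beta> \<inter> underS ?K \<alpha> \<subseteq> matrix_of \<kappa> \<mu> r \<xi> \<alpha>"
      using le_eta[OF S2[OF \<beta> \<alpha>] _ \<xi>(2,3)] unfolding matrix_of_def by fast
    then show ?thesis using \<xi>(1) by blast
  qed (use \<eta> in blast)
  show ?thesis
    unfolding strong_matrix_def by (intro conjI ballI impI G1 G2 G3 G4)
qed

end
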